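(* Assume that $\mathcal X$ is separable and $0<\gamma<2/\|A\|^2$. Let $\{y^{\delta_n}\}$ be any sequence of noisy data satisfying $\|y^{\delta_n}-y\|\le\delta_n$ with $\delta_n\to0$ as $n\to\infty$, and let $\{x_k^{\delta_n}\}_{k\ge0}$ be the iterative sequence produced by the RBCD method with data $y^{\delta_n}$. Let the (deterministic) integers $k_n$ be chosen such that $k_n\to\infty$ and $k_n\delta_n^2\to0$ as $n\to\infty$. Let $\bar x$ be the random solution of $Ax=y$ that is the almost sure weak limit of the exact-data sequence $\{x_k\}$ (i.e. $A\bar x=y$ and $x_k\rightharpoonup\bar x$ as $k\to\infty$ almost surely). Then, after passing to a subsequence of $\{x_{k_n}^{\delta_n}\}$ if necessary, $x_{k_n}^{\delta_n}\rightharpoonup\bar x$ weakly in $\mathcal X$ as $n\to\infty$ almost surely.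
   Context: Let $b\ge1$, let $X_1,\dots,X_b$ and $\mathcal Y$ be real Hilbert spaces, and let $A_i:X_i\to\mathcal Y$ be bounded linear operators with adjoints $A_i^*$. Let $\mathcal X:=X_1\times\cdots\times X_b$ with the natural product inner product and define $A:\mathcal X\to\mathcal Y$, $Ax:=\sum_{i=1}^bA_ix_i$ for $x=(x_1,\dots,x_b)$. It is assumed that $y\in\mathrm{Ran}(A)$. RBCD method with data $\tilde y\in\mathcal Y$, initial guess $x_0\in\mathcal X$, step size $\gamma>0$: let $i_0,i_1,i_2,\dots$ be independent random indices, each uniformly distributed on $\{1,\dots,b\}$. Starting from $x_0$, for $k\ge0$ the iterate with index $k+1$ is obtained from $\tilde x_k$ by $\tilde x_{k+1,i}=\tilde x_{k,i}$ for $i\ne i_k$ and $\tilde x_{k+1,i_k}=\tilde x_{k,i_k}-\gamma A_{i_k}^*(A\tilde x_k-\tilde y)$. The iterates with data $y^{\delta_n}$ are denoted $x_k^{\delta_n}$, those with the exact data $y$ are denoted $x_k$; all these sequences use the same $x_0$, $\gamma$ and the same random index sequence $\{i_k\}$. When $\mathcal X$ is separable and $0<\gamma<2/\|A\|^2$, the exact-data sequence $\{x_k\}$ converges weakly almost surely to a random solution $\bar x$ of $Ax=y$. "$\rightharpoonup$" denotes weak convergence. *)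

theory Defs
  imports "HOL-Probability.Independent_Family"
begin

text \<open>The blocks \<open>X\<^sub>1, \<dots>, X\<^sub>b\<close> may be different Hilbert spaces. They are
  represented as complete subspaces \<open>X i\<close> of one real inner product space \<open>'a\<close>, indexed by a
  finite type \<open>'b\<close> with \<open>b = CARD('b)\<close>. Every finite family of Hilbert spaces arises this way,
  up to isometry, inside its direct sum. Operators defined on a block are only constrained
  on that block, so the notions below are relative to a carrier.\<close>

definition hilbert_subspace :: "'a::real_inner set \<Rightarrow> bool" where
  "hilbert_subspace S \<longleftrightarrow> subspace S \<and> complete S"

definition bounded_linear_on ::
    "'a::real_normed_vector set \<Rightarrow> ('a \<Rightarrow> 'c::real_normed_vector) \<Rightarrow> bool" where
  "bounded_linear_on S f \<longleftrightarrow>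
     (\<forall>x\<in>S. \<forall>z\<in>S. f (x + z) = f x + f z) \<and>
     (\<forall>c. \<forall>x\<in>S. f (c *\<^sub>R x) = c *\<^sub>R f x) \<and>
     (\<exists>K. \<forall>x\<in>S. norm (f x) \<le> norm x * K)"

definition onorm_on ::
    "'a::real_normed_vector set \<Rightarrow> ('a \<Rightarrow> 'c::real_normed_vector) \<Rightarrow> real" where
  "onorm_on S f = (SUP x\<in>S. norm (f x) / norm x)"

text \<open>The adjoint of \<open>f : S \<rightarrow> 'c\<close>, with values in \<open>S\<close>. It is uniquely determined, and by the
  Riesz representation theorem it exists, for a bounded linear \<open>f\<close> on a Hilbert space \<open>S\<close>.\<close>

definition adjoint_on :: "'a::real_inner set \<Rightarrow> ('a \<Rightarrow> 'c::real_inner) \<Rightarrow> 'c \<Rightarrow> 'a" where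
  "adjoint_on S f v = (THE z. z \<in> S \<and> (\<forall>x\<in>S. inner (f x) v = inner x z))"

definition weakly_converges_on ::
    "'a::real_normed_vector set \<Rightarrow> (nat \<Rightarrow> 'a) \<Rightarrow> 'a \<Rightarrow> bool" where
  "weakly_converges_on S u l \<longleftrightarrow>
     (\<forall>\<phi>::'a \<Rightarrow> real. bounded_linear_on S \<phi> \<longrightarrow> (\<lambda>n. \<phi> (u n)) \<longlonglongrightarrow> \<phi> l)"

text \<open>The inner product of \<open>'a ^ 'b\<close> is the sum of the componentwise inner products, so the
  following set carries the natural inner product of \<open>X\<^sub>1 \<times> \<dots> \<times> X\<^sub>b\<close>.\<close>

definition block_space :: "('b::finite \<Rightarrow> 'a::real_inner set) \<Rightarrow> ('a ^ 'b) set" where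
  "block_space X = {x. \<forall>i. x $ i \<in> X i}"

definition block_op :: "('b::finite \<Rightarrow> 'a \<Rightarrow> 'c::real_inner) \<Rightarrow> 'a ^ 'b \<Rightarrow> 'c" where
  "block_op A x = (\<Sum>i\<in>UNIV. A i (x $ i))"

primrec rbcd ::
    "('b::finite \<Rightarrow> 'a::real_inner set) \<Rightarrow> ('b \<Rightarrow> 'a \<Rightarrow> 'c::real_inner) \<Rightarrow> real \<Rightarrow> 'a ^ 'b
      \<Rightarrow> 'c \<Rightarrow> (nat \<Rightarrow> 'b) \<Rightarrow> nat \<Rightarrow> 'a ^ 'b" where
  "rbcd X A \<gamma> x0 v I 0 = x0"
| "rbcd X A \<gamma> x0 v I (Suc k) =
     (\<chi> i. if i = I k
           then rbcd X A \<gamma> x0 v I k $ i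
                  - \<gamma> *\<^sub>R adjoint_on (X i) (A i) (block_op A (rbcd X A \<gamma> x0 v I k) - v)
           else rbcd X A \<gamma> x0 v I k $ i)"

end

theory Submission
  imports Defs "HOL-Analysis.Infinite_Set_Sum"
begin

text \<open>The difference \<open>e\<close> of the noisy and the exact iterates is itself an RBCD iteration, started
  at \<open>0\<close> with data \<open>d = y\<^sup>\<delta> - y\<close>. With \<open>u = A e\<close> and \<open>q = \<gamma> \<parallel>A\<parallel>\<^sup>2 < 2\<close>, averaging one step over
  the index changes \<open>\<parallel>e\<parallel>\<^sup>2\<close> by at most
  \<open>(\<gamma>/b) (q \<parallel>u - d\<parallel>\<^sup>2 - 2 \<langle>u, u - d\<rangle>) \<le> \<gamma> \<parallel>d\<parallel>\<^sup>2 / (b (2 - q))\<close>. Hence the expectation of \<open>\<parallel>e\<parallel>\<^sup>2\<close>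
  after \<open>k\<^sub>n\<close> steps is \<open>O(k\<^sub>n \<delta>\<^sub>n\<^sup>2)\<close>, so a subsequence of the differences tends to \<open>0\<close> in norm
  almost surely, and the weak limit of the exact iterates is inherited.\<close>

section \<open>Bounded linear maps on a subspace and Riesz representation\<close>

lemma bounded_linear_onD:
  assumes "bounded_linear_on S f"
  shows "x \<in> S \<Longrightarrow> z \<in> S \<Longrightarrow> f (x + z) = f x + f z"
    and "x \<in> S \<Longrightarrow> f (c *\<^sub>R x) = c *\<^sub>R f x"
  using assms unfolding bounded_linear_on_def by blast+

lemma bounded_linear_on_bound:
  assumes "bounded_linear_on S f"
  obtains K where "K \<ge> 0" "\<And>x. x \<in> S \<Longrightarrow> norm (f x) \<le> K * norm x"
proof -
  obtain K where K: "\<And>x. x \<in> S \<Longrightarrow> norm (f x) \<le> norm x * K"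
    using assms unfolding bounded_linear_on_def by blast
  have "norm (f x) \<le> max K 0 * norm x" if "x \<in> S" for x
    using K[OF that] mult_left_mono[of K "max K 0" "norm x"] by (simp add: mult.commute)
  then show ?thesis using that[of "max K 0"] by simp
qed

lemma bounded_linear_on_diff:
  assumes "subspace S" "bounded_linear_on S f" "x \<in> S" "z \<in> S"
  shows "f (x - z) = f x - f z"
proof -
  have "f (x + (- 1) *\<^sub>R z) = f x + (- 1) *\<^sub>R f z"
    using assms bounded_linear_onD[OF assms(2)] subspace_scale[OF assms(1)] by metis
  then show ?thesis by simp
qed

lemma bounded_linear_on_zero:
  assumes "subspace S" "bounded_linear_on S f"
  shows "f 0 = 0"
  using bounded_linear_on_diff[OF assms, of 0 0] subspace_0[OF assms(1)] by simp

text \<open>The representing vector is found as the minimizer of \<open>\<parallel>x\<parallel>\<^sup>2 - 2 \<phi> x\<close>; the parallelogram law makes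
  every minimizing sequence Cauchy.\<close>

lemma riesz_representation_on:
  fixes \<phi> :: "'a::real_inner \<Rightarrow> real"
  assumes S: "hilbert_subspace S" and bl: "bounded_linear_on S \<phi>"
  shows "\<exists>z\<in>S. \<forall>x\<in>S. \<phi> x = inner x z"
proof -
  have sub: "subspace S" and comp: "complete S"
    using S unfolding hilbert_subspace_def by auto
  note add = bounded_linear_onD(1)[OF bl] and scale = bounded_linear_onD(2)[OF bl]
  obtain K where K: "K \<ge> 0" "\<And>x. x \<in> S \<Longrightarrow> norm (\<phi> x) \<le> K * norm x"
    using bounded_linear_on_bound[OF bl] by blast
  define J where "J x = (norm x)\<^sup>2 - 2 * \<phi> x" for x
  define m where "m = Inf (J ` S)"
  \<comment> \<open>Completing the square in \<open>norm x\<close> bounds \<open>J\<close> from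
    below, so \<open>m\<close> is a genuine infimum and not an arbitrary value of
    \<open>Inf\<close>.\<close>
  have J_ge: "- K\<^sup>2 \<le> J x" if "x \<in> S" for x
  proof -
    have "0 \<le> (norm x - K)\<^sup>2" by simp
    then have "- K\<^sup>2 \<le> (norm x)\<^sup>2 - 2 * (K * norm x)" by (simp add: power2_diff algebra_simps)
    moreover have "\<phi> x \<le> K * norm x" using K(2)[OF that] by simp
    ultimately show ?thesis unfolding J_def by simp
  qed
  have bdd: "bdd_below (J ` S)" using J_ge by (auto intro!: bdd_belowI)
  have m_le: "m \<le> J x" if "x \<in> S" for x
    unfolding m_def using bdd that by (auto intro: cInf_lower)
  have "\<exists>x\<in>S. J x < m + inverse (real (Suc n))" for n
  proof -
    have "J ` S \<noteq> {}" using subspace_0[OF sub] by auto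
    moreover have "m < m + inverse (real (Suc n))" by simp
    ultimately obtain a where "a \<in> J ` S" "a < m + inverse (real (Suc n))"
      unfolding m_def by (rule cInf_lessD[THEN bexE])
    then show ?thesis by blast
  qed
  then obtain X where XS: "\<And>n. X n \<in> S" and XJ: "\<And>n. J (X n) < m + inverse (real (Suc n))"
    by metis
  have par: "(norm (x - z))\<^sup>2 \<le> 2 * (J x - m) + 2 * (J z - m)" if "x \<in> S" "z \<in> S" for x z
  proof -
    let ?h = "(1/2) *\<^sub>R (x + z)"
    have h: "?h \<in> S" using that sub by (simp add: subspace_add subspace_scale)
    have "\<phi> ?h = (\<phi> x + \<phi> z) / 2"
      using add[OF that] scale[of "x + z" "1/2"] that sub by (simp add: subspace_add)
    moreover have "(norm ?h)\<^sup>2 = (norm (x + z))\<^sup>2 / 4"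
      by (simp add: power_divide)
    moreover have "(norm (x + z))\<^sup>2 + (norm (x - z))\<^sup>2 = 2 * (norm x)\<^sup>2 + 2 * (norm z)\<^sup>2"
      by (simp add: power2_norm_eq_inner inner_simps)
    ultimately have "(norm (x - z))\<^sup>2 = 2 * J x + 2 * J z - 4 * J ?h"
      unfolding J_def by (simp add: field_simps)
    then show ?thesis using m_le[OF h] by simp
  qed
  have "Cauchy X"
  proof (rule metric_CauchyI)
    fix e :: real assume "e > 0"
    \<comment> \<open>The estimate \<open>par\<close> weights each of the two excesses over
      \<open>m\<close> by 2, so a tolerance of \<open>e\<^sup>2 / 4\<close> for each adds up to
      \<open>e\<^sup>2\<close>.\<close>
    then obtain N where N: "inverse (real (Suc N)) < e\<^sup>2 / 4"
      using reals_Archimedean[of "e\<^sup>2 / 4"] by auto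
    have tail: "J (X n) - m < e\<^sup>2 / 4" if "n \<ge> N" for n
    proof -
      have "inverse (real (Suc n)) \<le> inverse (real (Suc N))"
        using that by (intro le_imp_inverse_le) auto
      then show ?thesis using XJ[of n] N by linarith
    qed
    have "dist (X p) (X n) < e" if "p \<ge> N" "n \<ge> N" for p n
    proof -
      have "(norm (X p - X n))\<^sup>2 \<le> 2 * (J (X p) - m) + 2 * (J (X n) - m)"
        by (rule par[OF XS XS])
      also have "\<dots> < 2 * (e\<^sup>2 / 4) + 2 * (e\<^sup>2 / 4)"
        using tail that by (intro add_strict_mono mult_strict_left_mono) auto
      finally have "(norm (X p - X n))\<^sup>2 < e\<^sup>2" by simp
      then show ?thesis
        using \<open>e > 0\<close> power2_less_imp_less[of "norm (X p - X n)" e] by (simp add: dist_norm)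
    qed
    then show "\<exists>M. \<forall>p\<ge>M. \<forall>n\<ge>M. dist (X p) (X n) < e" by blast
  qed
  then obtain z where z: "z \<in> S" and lim: "X \<longlonglongrightarrow> z"
    using comp XS unfolding complete_def by blast
  have "(\<lambda>n. \<phi> (X n) - \<phi> z) \<longlonglongrightarrow> 0"
  proof (rule Lim_null_comparison)
    show "\<forall>\<^sub>F n in sequentially. norm (\<phi> (X n) - \<phi> z) \<le> K * norm (X n - z)"
      using K(2)[OF subspace_diff[OF sub XS z]] bounded_linear_on_diff[OF sub bl XS z] by auto
    show "(\<lambda>n. K * norm (X n - z)) \<longlonglongrightarrow> 0"
      using tendsto_mult_right_zero[OF tendsto_norm_zero[OF LIM_zero[OF lim]]] .
  qed
  then have "(\<lambda>n. J (X n)) \<longlonglongrightarrow> J z"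
    unfolding J_def by (intro tendsto_intros lim) (rule LIM_zero_cancel)
  moreover have "(\<lambda>n. m + inverse (real (Suc n))) \<longlonglongrightarrow> m + 0"
    by (intro tendsto_intros LIMSEQ_inverse_real_of_nat)
  \<comment> \<open>\<open>J\<close> is continuous along the minimizing sequence, so the infimum is
    attained at \<open>z\<close>.\<close>
  ultimately have "J z \<le> m"
    using XJ by (intro LIMSEQ_le[of "\<lambda>n. J (X n)" _ "\<lambda>n. m + inverse (real (Suc n))"])
      (auto intro: less_imp_le)
  have "\<phi> x = inner x z" if x: "x \<in> S" for x
  proof -
    define c where "c = inner x z - \<phi> x"
    \<comment> \<open>The quadratic in \<open>t\<close> below is nonnegative because
      \<open>z\<close> minimizes \<open>J\<close>. Inserting \<open>t = - (c / s)\<close> turns it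
      into \<open>- (c\<^sup>2 * (s + 1)) / s\<^sup>2\<close>, which forces \<open>c = 0\<close>.
      The summand 1 keeps \<open>s\<close> positive also for \<open>x = 0\<close>.\<close>
    define s where "s = (norm x)\<^sup>2 + 1"
    have s: "s > 0" by (simp add: s_def add_nonneg_pos)
    have "(norm (z + t *\<^sub>R x))\<^sup>2 = (norm z)\<^sup>2 + 2 * t * inner x z + t\<^sup>2 * (norm x)\<^sup>2" for t
      unfolding power2_norm_eq_inner
      by (simp add: inner_simps inner_commute power2_eq_square algebra_simps)
    then have expand: "J (z + t *\<^sub>R x) = J z + 2 * t * c + t\<^sup>2 * (norm x)\<^sup>2" for t
      unfolding J_def c_def using add[OF z subspace_scale[OF sub x]] scale[OF x]
      by (simp add: algebra_simps)
    have "0 \<le> 2 * t * c + t\<^sup>2 * (norm x)\<^sup>2" for t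
      using expand[of t] m_le[of "z + t *\<^sub>R x"] \<open>J z \<le> m\<close> z x sub
      by (simp add: subspace_add subspace_scale)
    from this[of "- (c / s)"] have "0 \<le> - 2 * c\<^sup>2 / s + c\<^sup>2 * (s - 1) / s\<^sup>2"
      by (simp add: s_def power2_eq_square)
    also have "\<dots> = - (c\<^sup>2 * (s + 1)) / s\<^sup>2"
      using s by (simp add: field_simps power2_eq_square)
    finally have "c\<^sup>2 * (s + 1) \<le> 0" using s by (simp add: field_simps)
    then have "c\<^sup>2 \<le> 0" using s by (simp add: mult_le_0_iff)
    then show ?thesis by (simp add: c_def)
  qed
  then show ?thesis using z by blast
qed

section \<open>Adjoints relative to a subspace\<close>

lemma adjoint_on_eqI:
  assumes "subspace S" "z \<in> S" "\<And>x. x \<in> S \<Longrightarrow> inner (f x) v = inner x z"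
  shows "adjoint_on S f v = z"
  unfolding adjoint_on_def
proof (rule the_equality)
  show "z \<in> S \<and> (\<forall>x\<in>S. inner (f x) v = inner x z)" using assms by blast
next
  fix w assume w: "w \<in> S \<and> (\<forall>x\<in>S. inner (f x) v = inner x w)"
  \<comment> \<open>Uniqueness: both candidates represent the same functional on \<open>S\<close>,
    so their difference, itself in \<open>S\<close>, can be used as the test vector.\<close>
  then have "w - z \<in> S" using assms by (simp add: subspace_diff)
  then have "inner (w - z) w = inner (w - z) z" using w assms(3) by metis
  then have "inner (w - z) (w - z) = 0" by (simp add: inner_diff_right)
  then show "w = z" by simp
qed

text \<open>Riesz representation applied to the functional \<open>\<lambda>x. inner (f x) v\<close>,
  bounded by \<open>K * norm v\<close>. This gives the existence that makes the description in
  \<open>adjoint_on\<close> meaningful.\<close>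

lemma adjoint_on_works:
  fixes f :: "'a::real_inner \<Rightarrow> 'c::real_inner"
  assumes S: "hilbert_subspace S" and bl: "bounded_linear_on S f"
  shows "adjoint_on S f v \<in> S" "x \<in> S \<Longrightarrow> inner (f x) v = inner x (adjoint_on S f v)"
proof -
  obtain K where K: "K \<ge> 0" "\<And>x. x \<in> S \<Longrightarrow> norm (f x) \<le> K * norm x"
    using bounded_linear_on_bound[OF bl] by blast
  have "norm (inner (f x) v) \<le> norm x * (K * norm v)" if "x \<in> S" for x
    using Cauchy_Schwarz_ineq2[of "f x" v] mult_right_mono[OF K(2)[OF that], of "norm v"]
    by (simp add: algebra_simps)
  then have "bounded_linear_on S (\<lambda>x. inner (f x) v)"
    using bounded_linear_onD[OF bl] unfolding bounded_linear_on_def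
    by (auto simp: inner_add_left)
  then obtain z where z: "z \<in> S" "\<And>x. x \<in> S \<Longrightarrow> inner (f x) v = inner x z"
    using riesz_representation_on[OF S] by blast
  moreover have "subspace S" using S by (simp add: hilbert_subspace_def)
  ultimately have "adjoint_on S f v = z" by (intro adjoint_on_eqI)
  then show "adjoint_on S f v \<in> S" "x \<in> S \<Longrightarrow> inner (f x) v = inner x (adjoint_on S f v)"
    using z by auto
qed

text \<open>By uniqueness: the difference of the two adjoint values has the defining property of the
  adjoint at \<open>v - w\<close>.\<close>

lemma adjoint_on_diff:
  fixes f :: "'a::real_inner \<Rightarrow> 'c::real_inner"
  assumes S: "hilbert_subspace S" and bl: "bounded_linear_on S f"
  shows "adjoint_on S f (v - w) = adjoint_on S f v - adjoint_on S f w"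
  using S adjoint_on_works[OF S bl]
  by (intro adjoint_on_eqI) (auto simp: hilbert_subspace_def subspace_diff inner_diff_right)

section \<open>Operator norm relative to a subspace\<close>

lemma bdd_above_onorm_on:
  assumes "bounded_linear_on S f"
  shows "bdd_above ((\<lambda>x. norm (f x) / norm x) ` S)"
proof -
  obtain K where K: "K \<ge> 0" "\<And>x. x \<in> S \<Longrightarrow> norm (f x) \<le> K * norm x"
    using bounded_linear_on_bound[OF assms] by blast
  \<comment> \<open>At \<open>x = 0\<close> the quotient is \<open>0\<close> by the convention on
    division, and \<open>K \<ge> 0\<close> covers this case.\<close>
  have "norm (f x) / norm x \<le> K" if "x \<in> S" for x
    using K(2)[OF that] K(1) by (cases "x = 0") (simp_all add: divide_le_eq)
  then show ?thesis by (auto intro!: bdd_aboveI)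
qed

lemma onorm_on_nonneg:
  assumes "bounded_linear_on S f" "S \<noteq> {}"
  shows "0 \<le> onorm_on S f"
proof -
  obtain x where "x \<in> S" using assms(2) by blast
  then have "norm (f x) / norm x \<le> onorm_on S f"
    unfolding onorm_on_def using bdd_above_onorm_on[OF assms(1)] by (intro cSUP_upper)
  moreover have "0 \<le> norm (f x) / norm x" by simp
  ultimately show ?thesis by linarith
qed

lemma norm_le_onorm_on:
  assumes "bounded_linear_on S f" "subspace S" "x \<in> S"
  shows "norm (f x) \<le> onorm_on S f * norm x"
proof (cases "x = 0")
  case True
  then show ?thesis using bounded_linear_on_zero[OF assms(2,1)] by simp
next
  case False
  have "norm (f x) / norm x \<le> onorm_on S f"
    unfolding onorm_on_def using assms(3) bdd_above_onorm_on[OF assms(1)] by (intro cSUP_upper)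
  then show ?thesis using False by (simp add: divide_le_eq)
qed

text \<open>A step at block \<open>j\<close> alters only the \<open>j\<close>-th summand of the
  squared norm. Summed over all \<open>j\<close>, the changes of the single blocks reassemble into
  the full inner product of \<open>x\<close> and \<open>w\<close> and the full squared norm of
  \<open>w\<close>, while the unchanged part is counted once per block.\<close>

lemma sum_norm_block_step:
  "(\<Sum>j\<in>UNIV. (norm (\<chi> i. if i = j then x $ i - \<gamma> *\<^sub>R w $ i else x $ i))\<^sup>2)
     = real CARD('b) * (norm x)\<^sup>2 - 2 * \<gamma> * inner x w + \<gamma>\<^sup>2 * (norm w)\<^sup>2"
  for x w :: "'a::real_inner ^ 'b::finite"
proof -
  have "(norm (\<chi> i. if i = j then x $ i - \<gamma> *\<^sub>R w $ i else x $ i))\<^sup>2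
      = (norm x)\<^sup>2 + (- 2 * \<gamma> * inner (x $ j) (w $ j) + \<gamma>\<^sup>2 * inner (w $ j) (w $ j))" for j
  proof -
    have "(norm (\<chi> i. if i = j then x $ i - \<gamma> *\<^sub>R w $ i else x $ i))\<^sup>2
      = (\<Sum>i\<in>UNIV. inner (x $ i) (x $ i) + (if i = j then
           - 2 * \<gamma> * inner (x $ i) (w $ i) + \<gamma>\<^sup>2 * inner (w $ i) (w $ i) else 0))"
      unfolding power2_norm_eq_inner inner_vec_def
      by (intro sum.cong refl)
        (simp add: inner_diff_left inner_diff_right inner_commute power2_eq_square algebra_simps)
    then show ?thesis
      by (simp add: sum.distrib power2_norm_eq_inner inner_vec_def)
  qed
  then show ?thesis
    by (simp add: sum.distrib sum_subtractf sum_distrib_left power2_norm_eq_inner inner_vec_def)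
qed

section \<open>The block operator and its adjoint\<close>

locale block_operator =
  fixes X :: "'b::finite \<Rightarrow> 'a::real_inner set"
    and A :: "'b \<Rightarrow> 'a \<Rightarrow> 'c::real_inner"
  assumes hilbert: "\<And>i. hilbert_subspace (X i)"
    and bounded: "\<And>i. bounded_linear_on (X i) (A i)"
begin

lemma subspace_block: "subspace (X i)"
  using hilbert by (simp add: hilbert_subspace_def)

lemma subspace_block_space: "subspace (block_space X)"
  using subspace_block unfolding subspace_def block_space_def by simp

lemma bounded_linear_on_block_op: "bounded_linear_on (block_space X) (block_op A)"
proof -
  have "\<exists>K\<ge>0. \<forall>z\<in>X i. norm (A i z) \<le> K * norm z" for i
    using bounded_linear_on_bound[OF bounded] by metis
  then obtain K where K: "\<And>i. K i \<ge> 0" "\<And>i z. z \<in> X i \<Longrightarrow> norm (A i z) \<le> K i * norm z"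
    by metis
  \<comment> \<open>Every component has norm at most \<open>norm x\<close>, so the block constants
    simply add up.\<close>
  have "norm (block_op A x) \<le> norm x * (\<Sum>i\<in>UNIV. K i)" if "x \<in> block_space X" for x
  proof -
    have "norm (A i (x $ i)) \<le> norm x * K i" for i
    proof -
      have "norm (A i (x $ i)) \<le> K i * norm (x $ i)"
        using K(2) that by (simp add: block_space_def)
      also have "\<dots> \<le> K i * norm x"
        using K(1) Finite_Cartesian_Product.norm_nth_le[of x i] by (intro mult_left_mono)
      finally show ?thesis by (simp add: mult.commute)
    qed
    then show ?thesis
      unfolding block_op_def sum_distrib_left by (intro sum_norm_le)
  qed
  then show ?thesis
    using bounded_linear_onD[OF bounded]
    unfolding bounded_linear_on_def
    by (auto simp: block_op_def block_space_def sum.distrib scaleR_sum_right)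
qed

text \<open>The adjoint of \<open>block_op A\<close> for the product inner product. An RBCD step
  subtracts one component of \<gamma> times its value at the residual.\<close>

definition block_adjoint :: "'c \<Rightarrow> 'a ^ 'b" where
  "block_adjoint v = (\<chi> i. adjoint_on (X i) (A i) v)"

lemma block_adjoint_in: "block_adjoint v \<in> block_space X"
  using adjoint_on_works(1)[OF hilbert bounded] by (simp add: block_adjoint_def block_space_def)

lemma inner_block_adjoint:
  assumes "x \<in> block_space X"
  shows "inner (block_op A x) v = inner x (block_adjoint v)"
  using assms adjoint_on_works(2)[OF hilbert bounded]
  by (simp add: block_op_def block_adjoint_def block_space_def inner_vec_def inner_sum_left)

text \<open>With \<open>w = block_adjoint v\<close>, the adjoint relation and Cauchy-Schwarz bound
  the square of \<open>norm w\<close> by the operator norm times \<open>norm w * norm v\<close>. One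
  factor \<open>norm w\<close> then cancels; the case where it vanishes is separate.\<close>

lemma norm_block_adjoint_le:
  "norm (block_adjoint v) \<le> onorm_on (block_space X) (block_op A) * norm v"
proof (cases "block_adjoint v = 0")
  case True
  have "0 \<le> onorm_on (block_space X) (block_op A)"
    using onorm_on_nonneg[OF bounded_linear_on_block_op] subspace_0[OF subspace_block_space]
    by blast
  then show ?thesis using True by simp
next
  case False
  let ?w = "block_adjoint v" and ?L = "onorm_on (block_space X) (block_op A)"
  have "norm ?w * norm ?w = inner (block_op A ?w) v"
    using inner_block_adjoint[OF block_adjoint_in] by (simp add: power2_norm_eq_inner[symmetric] power2_eq_square)
  also have "\<dots> \<le> norm (block_op A ?w) * norm v" by (rule norm_cauchy_schwarz)
  also have "\<dots> \<le> (?L * norm ?w) * norm v"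
    using norm_le_onorm_on[OF bounded_linear_on_block_op subspace_block_space block_adjoint_in]
    by (intro mult_right_mono) auto
  finally have "norm ?w * norm ?w \<le> (?L * norm v) * norm ?w" by (simp add: algebra_simps)
  then show ?thesis using False by simp
qed

section \<open>The iteration: invariance, linearity and the averaged one-step bound\<close>

lemma rbcd_in:
  assumes "x0 \<in> block_space X"
  shows "rbcd X A \<gamma> x0 v I k \<in> block_space X"
proof (induction k)
  case 0
  then show ?case using assms by simp
next
  case (Suc k)
  then show ?case
    using adjoint_on_works(1)[OF hilbert bounded] subspace_diff[OF subspace_block]
      subspace_scale[OF subspace_block]
    by (auto simp: block_space_def)
qed

text \<open>Each step is linear in the pair of iterate and data on the block space, and both
  sequences share the indices. With equal initial guesses the difference starts at \<open>0\<close>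
  and is driven by the data error alone.\<close>

lemma rbcd_diff:
  assumes "x0 \<in> block_space X" "x1 \<in> block_space X"
  shows "rbcd X A \<gamma> x0 v I k - rbcd X A \<gamma> x1 w I k = rbcd X A \<gamma> (x0 - x1) (v - w) I k"
proof (induction k)
  case 0
  then show ?case by simp
next
  case (Suc k)
  let ?x = "rbcd X A \<gamma> x0 v I k" and ?z = "rbcd X A \<gamma> x1 w I k"
  have "block_op A (?x - ?z) = block_op A ?x - block_op A ?z"
    using bounded_linear_on_diff[OF subspace_block_space bounded_linear_on_block_op]
      rbcd_in assms by blast
  then have "block_op A (?x - ?z) - (v - w) = (block_op A ?x - v) - (block_op A ?z - w)"
    by simp
  then have adj: "adjoint_on (X i) (A i) (block_op A (?x - ?z) - (v - w))
      = adjoint_on (X i) (A i) (block_op A ?x - v) - adjoint_on (X i) (A i) (block_op A ?z - w)"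
    for i using adjoint_on_diff[OF hilbert bounded] by simp
  have swap: "(a - b) - (c - d) = (a - c) - (b - d)" for a b c d :: 'a by simp
  show ?case
    by (simp add: vec_eq_iff Suc.IH[symmetric] adj scaleR_diff_right swap)
qed

text \<open>The adjoint bound controls the quadratic term of \<open>sum_norm_block_step\<close>, and
  the step size condition lets the inner product term absorb it up to a multiple of the squared norm
  of \<open>d\<close>. Dividing by the number of blocks gives the average over a uniform
  index.\<close>

lemma sum_norm_rbcd_step_le:
  fixes d :: 'c and \<gamma> :: real
  assumes e: "e \<in> block_space X" and "0 < \<gamma>"
    and "\<gamma> * (onorm_on (block_space X) (block_op A))\<^sup>2 < 2"
  shows "(\<Sum>j\<in>UNIV. (norm (\<chi> i. if i = j
            then e $ i - \<gamma> *\<^sub>R adjoint_on (X i) (A i) (block_op A e - d) else e $ i))\<^sup>2)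
       \<le> real CARD('b) * (norm e)\<^sup>2
          + \<gamma> / (2 - \<gamma> * (onorm_on (block_space X) (block_op A))\<^sup>2) * (norm d)\<^sup>2"
proof -
  define L where "L = onorm_on (block_space X) (block_op A)"
  define q where "q = \<gamma> * L\<^sup>2"
  define u where "u = block_op A e"
  define w where "w = block_adjoint (u - d)"
  have q: "q < 2" using assms(3) by (simp add: q_def L_def)
  have "(norm w)\<^sup>2 \<le> (L * norm (u - d))\<^sup>2"
    using norm_block_adjoint_le by (intro power_mono) (auto simp: w_def L_def)
  then have "\<gamma> * (norm w)\<^sup>2 \<le> q * (norm (u - d))\<^sup>2"
    using \<open>0 < \<gamma>\<close> by (simp add: q_def power_mult_distrib mult.assoc)
  moreover have "q * (norm (u - d))\<^sup>2 - 2 * inner u (u - d) \<le> (norm d)\<^sup>2 / (2 - q)"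
  proof -
    \<comment> \<open>The left side of the claim is a concave quadratic in \<open>u\<close>, as
      \<open>q < 2\<close>. The vector whose norm is taken vanishes exactly at its maximizer,
      \<open>u = ((1 - q) / (2 - q)) *\<^sub>R d\<close>, so this is completion of the
      square.\<close>
    have "0 \<le> (norm ((2 - q) *\<^sub>R u - (1 - q) *\<^sub>R d))\<^sup>2" by simp
    also have "\<dots> = (norm d)\<^sup>2 - (2 - q) * (q * (norm (u - d))\<^sup>2 - 2 * inner u (u - d))"
      unfolding power2_norm_eq_inner
      by (simp add: inner_simps inner_commute algebra_simps power2_eq_square)
    finally show ?thesis using q by (simp add: le_divide_eq mult.commute)
  qed
  ultimately have "\<gamma> * (norm w)\<^sup>2 - 2 * inner u (u - d) \<le> (norm d)\<^sup>2 / (2 - q)"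
    by linarith
  then have "\<gamma> * (\<gamma> * (norm w)\<^sup>2 - 2 * inner u (u - d)) \<le> \<gamma> * ((norm d)\<^sup>2 / (2 - q))"
    using \<open>0 < \<gamma>\<close> by (intro mult_left_mono) auto
  \<comment> \<open>The adjoint relation moves the first-order term from the block space to the data
    space.\<close>
  moreover have "inner e w = inner u (u - d)"
    using inner_block_adjoint[OF e] by (simp add: u_def w_def)
  ultimately have "\<gamma> * (\<gamma> * (norm w)\<^sup>2 - 2 * inner e w) \<le> \<gamma> / (2 - q) * (norm d)\<^sup>2"
    by simp
  moreover have "real CARD('b) * (norm e)\<^sup>2 - 2 * \<gamma> * inner e w + \<gamma>\<^sup>2 * (norm w)\<^sup>2
      = real CARD('b) * (norm e)\<^sup>2 + \<gamma> * (\<gamma> * (norm w)\<^sup>2 - 2 * inner e w)"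
    by (simp add: power2_eq_square algebra_simps)
  ultimately have "(\<Sum>j\<in>UNIV. (norm (\<chi> i. if i = j then e $ i - \<gamma> *\<^sub>R w $ i else e $ i))\<^sup>2)
      \<le> real CARD('b) * (norm e)\<^sup>2 + \<gamma> / (2 - q) * (norm d)\<^sup>2"
    using sum_norm_block_step[of e \<gamma> w] by linarith
  then show ?thesis
    by (simp add: w_def block_adjoint_def u_def q_def L_def cong: if_cong)
qed

end

section \<open>Dependence of the iterates on finitely many indices\<close>

lemma rbcd_cong:
  assumes "\<And>j. j < k \<Longrightarrow> I j = I' j"
  shows "rbcd X A \<gamma> x0 v I k = rbcd X A \<gamma> x0 v I' k"
  using assms
proof (induction k)
  case (Suc k)
  then have "rbcd X A \<gamma> x0 v I k = rbcd X A \<gamma> x0 v I' k" by simp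
  with Suc.prems[of k] show ?case by (simp cong: if_cong)
qed simp

text \<open>This exhibits the \<open>k\<close>-th iterate as a function of the indices before
  \<open>k\<close>, a random vector with finitely many values that is independent of the index used
  in the next step.\<close>

lemma rbcd_restrict:
  "rbcd X A \<gamma> x0 v I k = rbcd X A \<gamma> x0 v (restrict I {..<k}) k"
  by (rule rbcd_cong) simp

section \<open>Averaging over a uniform index independent of the past\<close>

context prob_space
begin

text \<open>The first \<open>k\<close> indices take values in a finite set with the discrete
  sigma-algebra, so any real function of them is measurable and bounded.\<close>

lemma integrable_restrict_finite_values:
  fixes I :: "nat \<Rightarrow> 'a \<Rightarrow> 'b::finite" and f :: "(nat \<Rightarrow> 'b) \<Rightarrow> real"
  assumes "\<And>j. I j \<in> measurable M (count_space UNIV)"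
  shows "integrable M (\<lambda>\<omega>. f (restrict (\<lambda>j. I j \<omega>) {..<k}))"
proof -
  let ?P = "PiE {..<k} (\<lambda>_. UNIV :: 'b set)"
  have fin: "finite ?P" by (intro finite_PiE) auto
  have "(\<lambda>\<omega>. restrict (\<lambda>j. I j \<omega>) {..<k}) \<in> measurable M (PiM {..<k} (\<lambda>_. count_space UNIV))"
    using assms by (intro measurable_restrict)
  then have "(\<lambda>\<omega>. restrict (\<lambda>j. I j \<omega>) {..<k}) \<in> measurable M (count_space ?P)"
    by (simp add: count_space_PiM_finite)
  then have meas: "(\<lambda>\<omega>. f (restrict (\<lambda>j. I j \<omega>) {..<k})) \<in> borel_measurable M"
    by (rule measurable_compose) simp
  have "norm (f g) \<le> (\<Sum>h\<in>?P. norm (f h))" if "g \<in> ?P" for g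
    using fin that by (intro member_le_sum) auto
  then show ?thesis
    using meas by (intro integrable_const_bound[where B = "\<Sum>h\<in>?P. norm (f h)"]) auto
qed

text \<open>This replaces conditioning on the past: split by the value of the next index, factor
  each expectation by independence, and use that each value has probability one over the number of
  blocks.\<close>

lemma expectation_indep_uniform_next:
  fixes I :: "nat \<Rightarrow> 'a \<Rightarrow> 'b::finite" and F :: "(nat \<Rightarrow> 'b) \<Rightarrow> 'b \<Rightarrow> real"
  assumes ind: "indep_vars (\<lambda>_. count_space UNIV) I UNIV"
    and unif: "distr M (count_space UNIV) (I k) = uniform_count_measure UNIV"
  shows "expectation (\<lambda>\<omega>. F (restrict (\<lambda>j. I j \<omega>) {..<k}) (I k \<omega>))
       = expectation (\<lambda>\<omega>. \<Sum>i\<in>UNIV. F (restrict (\<lambda>j. I j \<omega>) {..<k}) i) / real CARD('b)"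
proof -
  have I[measurable]: "I j \<in> measurable M (count_space UNIV)" for j
    using ind by (simp add: indep_vars_def)
  let ?H = "\<lambda>\<omega>. restrict (\<lambda>j. I j \<omega>) {..<k}" and ?G = "\<lambda>i \<omega>. indicator {i} (I k \<omega>) :: real"
  have int: "integrable M (\<lambda>\<omega>. f (?H \<omega>))" for f :: "(nat \<Rightarrow> 'b) \<Rightarrow> real"
    using I by (rule integrable_restrict_finite_values)
  have intG: "integrable M (?G i)" for i
    by (intro integrable_const_bound[where B = 1]) auto
  have EG: "expectation (?G i) = 1 / real CARD('b)" for i
  proof -
    have "expectation (?G i) = (\<integral>x. indicator {i} x \<partial>distr M (count_space UNIV) (I k))"
      by (intro integral_distr[symmetric]) auto
    also have "\<dots> = measure (uniform_count_measure (UNIV :: 'b set)) {i}"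
      by (simp add: unif)
    also have "\<dots> = 1 / real CARD('b)" by (simp add: measure_uniform_count_measure)
    finally show ?thesis .
  qed
  have indep: "indep_var borel (\<lambda>\<omega>. F (?H \<omega>) i) borel (?G i)" for i
  proof -
    \<comment> \<open>The index sets \<open>{..<k}\<close> and \<open>{k}\<close> are disjoint, so
      the corresponding subfamilies are independent.\<close>
    have "indep_var (PiM {..<k} (\<lambda>_. count_space UNIV)) ?H
        (PiM {k} (\<lambda>_. count_space UNIV)) (\<lambda>\<omega>. restrict (\<lambda>j. I j \<omega>) {k})"
      using ind by (rule indep_var_restrict) auto
    then have "indep_var borel ((\<lambda>h. F h i) \<circ> ?H)
        borel ((\<lambda>g. indicator {i} (g k)) \<circ> (\<lambda>\<omega>. restrict (\<lambda>j. I j \<omega>) {k}))"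
      by (rule indep_var_compose) (simp_all add: count_space_PiM_finite)
    then show ?thesis by (simp add: comp_def)
  qed
  have split: "F (?H \<omega>) (I k \<omega>) = (\<Sum>i\<in>UNIV. F (?H \<omega>) i * ?G i \<omega>)" for \<omega>
    by (simp add: indicator_def if_distrib cong: if_cong)
  have "expectation (\<lambda>\<omega>. F (?H \<omega>) (I k \<omega>)) = (\<Sum>i\<in>UNIV. expectation (\<lambda>\<omega>. F (?H \<omega>) i * ?G i \<omega>))"
    unfolding split using indep_var_integrable[OF indep int intG]
    by (intro Bochner_Integration.integral_sum)
  also have "\<dots> = (\<Sum>i\<in>UNIV. expectation (\<lambda>\<omega>. F (?H \<omega>) i) / real CARD('b))"
    by (intro sum.cong refl)
      (simp only: indep_var_lebesgue_integral[OF indep int intG] EG times_divide_eq_right mult_1_right)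
  also have "\<dots> = expectation (\<lambda>\<omega>. \<Sum>i\<in>UNIV. F (?H \<omega>) i) / real CARD('b)"
    using int[of "\<lambda>h. F h i" for i]
    by (simp only: Bochner_Integration.integral_sum sum_divide_distrib)
  finally show ?thesis .
qed

end

section \<open>Second moment of the iteration started at zero\<close>

lemma (in prob_space) integrable_rbcd:
  fixes I :: "nat \<Rightarrow> 'a \<Rightarrow> 'b::finite" and f :: "'d::real_inner ^ 'b \<Rightarrow> real"
  assumes "\<And>j. I j \<in> measurable M (count_space UNIV)"
  shows "integrable M (\<lambda>\<omega>. f (rbcd X A \<gamma> x0 v (\<lambda>j. I j \<omega>) k))"
  by (subst rbcd_restrict) (rule integrable_restrict_finite_values[OF assms,
    of "\<lambda>h. f (rbcd X A \<gamma> x0 v h k)"])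

text \<open>Induction on \<open>k\<close> from the zero initial guess: averaging over the next index
  and applying the one-step bound adds the same multiple of the squared norm of \<open>d\<close>
  each time.\<close>

lemma (in prob_space) expectation_rbcd_zero_le:
  fixes X :: "'b::finite \<Rightarrow> 'd::real_inner set" and A :: "'b \<Rightarrow> 'd \<Rightarrow> 'c::real_inner"
    and I :: "nat \<Rightarrow> 'a \<Rightarrow> 'b"
  assumes "block_operator X A"
    and ind: "indep_vars (\<lambda>_. count_space UNIV) I UNIV"
    and unif: "\<And>j. distr M (count_space UNIV) (I j) = uniform_count_measure UNIV"
    and \<gamma>: "0 < \<gamma>" "\<gamma> * (onorm_on (block_space X) (block_op A))\<^sup>2 < 2"
  shows "expectation (\<lambda>\<omega>. (norm (rbcd X A \<gamma> 0 d (\<lambda>j. I j \<omega>) k))\<^sup>2)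
    \<le> real k * (\<gamma> / (2 - \<gamma> * (onorm_on (block_space X) (block_op A))\<^sup>2) / real CARD('b)
        * (norm d)\<^sup>2)"
proof (induction k)
  case 0
  then show ?case by simp
next
  case (Suc k)
  interpret block_operator X A by fact
  define C where "C = \<gamma> / (2 - \<gamma> * (onorm_on (block_space X) (block_op A))\<^sup>2)"
  let ?e = "\<lambda>h. rbcd X A \<gamma> 0 d h k"
  let ?step = "\<lambda>e j. (\<chi> i. if i = j
    then e $ i - \<gamma> *\<^sub>R adjoint_on (X i) (A i) (block_op A e - d) else e $ i)"
  let ?H = "\<lambda>\<omega>. restrict (\<lambda>j. I j \<omega>) {..<k}"
  have I: "I j \<in> measurable M (count_space UNIV)" for j
    using ind by (simp add: indep_vars_def)
  have int: "integrable M (\<lambda>\<omega>. f (?H \<omega>))" for f :: "(nat \<Rightarrow> 'b) \<Rightarrow> real"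
    using I by (rule integrable_restrict_finite_values)
  have e: "?e h \<in> block_space X" for h
    by (rule rbcd_in) (rule subspace_0[OF subspace_block_space])
  \<comment> \<open>Rewriting by the truncated history separates the past from the fresh index
    \<open>I k\<close>.\<close>
  have eH: "?e (\<lambda>j. I j \<omega>) = ?e (?H \<omega>)" for \<omega> by (rule rbcd_restrict)
  have "expectation (\<lambda>\<omega>. (norm (rbcd X A \<gamma> 0 d (\<lambda>j. I j \<omega>) (Suc k)))\<^sup>2)
      = expectation (\<lambda>\<omega>. (norm (?step (?e (?H \<omega>)) (I k \<omega>)))\<^sup>2)"
    by (simp only: rbcd.simps eH)
  also have "\<dots> = expectation (\<lambda>\<omega>. \<Sum>j\<in>UNIV. (norm (?step (?e (?H \<omega>)) j))\<^sup>2) / real CARD('b)"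
    by (rule expectation_indep_uniform_next[OF ind unif,
          of "\<lambda>h j. (norm (?step (?e h) j))\<^sup>2"])
  also have "\<dots> \<le> expectation (\<lambda>\<omega>. real CARD('b) * (norm (?e (?H \<omega>)))\<^sup>2 + C * (norm d)\<^sup>2)
      / real CARD('b)"
    using sum_norm_rbcd_step_le[OF e \<gamma>, folded C_def]
    by (intro divide_right_mono integral_mono Bochner_Integration.integrable_sum
        Bochner_Integration.integrable_add integrable_mult_right int integrable_const) auto
  also have "\<dots> = expectation (\<lambda>\<omega>. (norm (?e (?H \<omega>)))\<^sup>2) + C / real CARD('b) * (norm d)\<^sup>2"
    using int[of "\<lambda>h. (norm (?e h))\<^sup>2"] prob_space by (simp add: add_divide_distrib)
  also have "\<dots> \<le> real (Suc k) * (C / real CARD('b) * (norm d)\<^sup>2)"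
    using Suc.IH[folded C_def] unfolding eH by (simp add: algebra_simps add_divide_distrib)
  finally show ?case unfolding C_def .
qed

section \<open>Weak convergence along a subsequence\<close>

theorem theorem2p6:
  fixes X :: "'b::finite \<Rightarrow> 'a::real_inner set"
    and A :: "'b \<Rightarrow> 'a \<Rightarrow> 'c::{real_inner, complete_space}"
    and y :: 'c
    and x0 :: "'a ^ 'b"
    and \<gamma> :: real
    and M :: "'w measure"
    and I :: "nat \<Rightarrow> 'w \<Rightarrow> 'b"
    and \<delta> :: "nat \<Rightarrow> real"
    and y\<delta> :: "nat \<Rightarrow> 'c"
    and k :: "nat \<Rightarrow> nat"
    and xbar :: "'w \<Rightarrow> 'a ^ 'b"
  assumes "\<And>i. hilbert_subspace (X i)"
    and "\<And>i. bounded_linear_on (X i) (A i)"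
    and "y \<in> block_op A ` block_space X"
    and "x0 \<in> block_space X"
    and "separable_space (top_of_set (block_space X))"
    and "0 < \<gamma>" and "\<gamma> * (onorm_on (block_space X) (block_op A))\<^sup>2 < 2"
    and "prob_space M"
    and "prob_space.indep_vars M (\<lambda>_. count_space UNIV) I UNIV"
    and "\<And>j. distr M (count_space UNIV) (I j) = uniform_count_measure UNIV"
    and "\<And>n. norm (y\<delta> n - y) \<le> \<delta> n"
    and "\<delta> \<longlonglongrightarrow> 0"
    and "filterlim k at_top sequentially"
    and "(\<lambda>n. real (k n) * (\<delta> n)\<^sup>2) \<longlonglongrightarrow> 0"
    and "AE \<omega> in M. xbar \<omega> \<in> block_space X \<and> block_op A (xbar \<omega>) = y \<and>
           weakly_converges_on (block_space X) (rbcd X A \<gamma> x0 y (\<lambda>j. I j \<omega>)) (xbar \<omega>)"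
  shows "\<exists>r::nat \<Rightarrow> nat. strict_mono r \<and>
           (AE \<omega> in M. weakly_converges_on (block_space X)
              (\<lambda>n. rbcd X A \<gamma> x0 (y\<delta> (r n)) (\<lambda>j. I j \<omega>) (k (r n))) (xbar \<omega>))"
proof -
  interpret prob_space M by fact
  interpret block_operator X A using assms(1,2) by unfold_locales
  let ?e = "\<lambda>n \<omega>. rbcd X A \<gamma> 0 (y\<delta> n - y) (\<lambda>j. I j \<omega>) (k n)"
  define C where
    "C = \<gamma> / (2 - \<gamma> * (onorm_on (block_space X) (block_op A))\<^sup>2) / real CARD('b)"
  have C: "C \<ge> 0" using assms(6,7) by (simp add: C_def)
  have I: "I j \<in> measurable M (count_space UNIV)" for j
    using assms(9) by (simp add: indep_vars_def)
  have "(\<lambda>n. expectation (\<lambda>\<omega>. (norm (?e n \<omega>))\<^sup>2)) \<longlonglongrightarrow> 0"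
  proof (rule tendsto_sandwich[OF _ _ tendsto_const])
    show "\<forall>\<^sub>F n in sequentially. 0 \<le> expectation (\<lambda>\<omega>. (norm (?e n \<omega>))\<^sup>2)"
      by (simp add: Bochner_Integration.integral_nonneg)
    have "expectation (\<lambda>\<omega>. (norm (?e n \<omega>))\<^sup>2) \<le> C * (real (k n) * (\<delta> n)\<^sup>2)" for n
    proof -
      have "expectation (\<lambda>\<omega>. (norm (?e n \<omega>))\<^sup>2) \<le> real (k n) * (C * (norm (y\<delta> n - y))\<^sup>2)"
        unfolding C_def
        by (rule expectation_rbcd_zero_le[OF block_operator_axioms assms(9,10,6,7)])
      also have "\<dots> \<le> real (k n) * (C * (\<delta> n)\<^sup>2)"
        using assms(11) C by (intro mult_left_mono power_mono) auto
      finally show ?thesis by (simp add: algebra_simps)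
    qed
    then show "\<forall>\<^sub>F n in sequentially.
        expectation (\<lambda>\<omega>. (norm (?e n \<omega>))\<^sup>2) \<le> C * (real (k n) * (\<delta> n)\<^sup>2)"
      by simp
    show "(\<lambda>n. C * (real (k n) * (\<delta> n)\<^sup>2)) \<longlonglongrightarrow> 0"
      using assms(14) by (rule tendsto_mult_right_zero)
  qed
  \<comment> \<open>Convergence in mean yields almost sure convergence along a subsequence. The
    subsequence \<open>r\<close> is deterministic: it is chosen before
    \<open>\<omega>\<close>.\<close>
  then have "\<exists>r::nat \<Rightarrow> nat. strict_mono r \<and> (AE \<omega> in M. (\<lambda>n. (norm (?e (r n) \<omega>))\<^sup>2) \<longlonglongrightarrow> 0)"
    by (intro tendsto_L1_AE_subseq integrable_rbcd[OF I]) simp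
  then obtain r :: "nat \<Rightarrow> nat" where r: "strict_mono r"
      and conv: "AE \<omega> in M. (\<lambda>n. (norm (?e (r n) \<omega>))\<^sup>2) \<longlonglongrightarrow> 0"
    by blast
  have "AE \<omega> in M. weakly_converges_on (block_space X)
      (\<lambda>n. rbcd X A \<gamma> x0 (y\<delta> (r n)) (\<lambda>j. I j \<omega>) (k (r n))) (xbar \<omega>)"
    using conv assms(15)
  proof eventually_elim
    case (elim \<omega>)
    let ?x = "\<lambda>v n. rbcd X A \<gamma> x0 v (\<lambda>j. I j \<omega>) n"
    have "(\<lambda>n. sqrt ((norm (?e (r n) \<omega>))\<^sup>2)) \<longlonglongrightarrow> sqrt 0"
      using elim(1) by (rule tendsto_real_sqrt)
    then have e0: "(\<lambda>n. norm (?e (r n) \<omega>)) \<longlonglongrightarrow> 0" by simp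
    \<comment> \<open>The stopping indices still tend to infinity along \<open>r\<close>, so the
      exact iterates taken at them keep the weak limit \<open>xbar \<omega>\<close>.\<close>
    have kr: "filterlim (\<lambda>n. k (r n)) at_top sequentially"
      using assms(13) filterlim_subseq[OF r] by (rule filterlim_compose)
    show ?case
      unfolding weakly_converges_on_def
    proof (intro allI impI)
      fix \<phi> :: "'a ^ 'b \<Rightarrow> real"
      assume \<phi>: "bounded_linear_on (block_space X) \<phi>"
      obtain K where K: "K \<ge> 0" "\<And>x. x \<in> block_space X \<Longrightarrow> norm (\<phi> x) \<le> K * norm x"
        using bounded_linear_on_bound[OF \<phi>] by blast
      have "(\<lambda>n. \<phi> (?x y n)) \<longlonglongrightarrow> \<phi> (xbar \<omega>)"
        using elim(2) \<phi> by (simp add: weakly_converges_on_def)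
      then have exact: "(\<lambda>n. \<phi> (?x y (k (r n)))) \<longlonglongrightarrow> \<phi> (xbar \<omega>)"
        using kr by (rule filterlim_compose)
      \<comment> \<open>By linearity \<phi> is applied to the error
        \<open>?e (r n) \<omega>\<close>, whose norm tends to zero; strong convergence of the error
        thus transfers the weak limit.\<close>
      have "(\<lambda>n. \<phi> (?x (y\<delta> (r n)) (k (r n))) - \<phi> (?x y (k (r n)))) \<longlonglongrightarrow> 0"
      proof (rule Lim_null_comparison)
        show "\<forall>\<^sub>F n in sequentially. norm (\<phi> (?x (y\<delta> (r n)) (k (r n))) - \<phi> (?x y (k (r n))))
            \<le> K * norm (?e (r n) \<omega>)"
        proof (rule always_eventually, rule allI)
          fix n
          have in1: "?x v m \<in> block_space X" for v m
            using rbcd_in assms(4) .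
          have "\<phi> (?x (y\<delta> (r n)) (k (r n))) - \<phi> (?x y (k (r n)))
              = \<phi> (?x (y\<delta> (r n)) (k (r n)) - ?x y (k (r n)))"
            using bounded_linear_on_diff[OF subspace_block_space \<phi> in1 in1] by simp
          also have "?x (y\<delta> (r n)) (k (r n)) - ?x y (k (r n)) = ?e (r n) \<omega>"
            using rbcd_diff[OF assms(4,4)] by simp
          finally show "norm (\<phi> (?x (y\<delta> (r n)) (k (r n))) - \<phi> (?x y (k (r n))))
              \<le> K * norm (?e (r n) \<omega>)"
            using K(2) rbcd_in[OF subspace_0[OF subspace_block_space]] by simp
        qed
        show "(\<lambda>n. K * norm (?e (r n) \<omega>)) \<longlonglongrightarrow> 0"
          using e0 by (rule tendsto_mult_right_zero)
      qed
      from tendsto_add[OF this exact]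
      show "(\<lambda>n. \<phi> (?x (y\<delta> (r n)) (k (r n)))) \<longlonglongrightarrow> \<phi> (xbar \<omega>)" by simp
    qed
  qed
  with r show ?thesis by blast
qed

end
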